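(* Let $\mathcal{B}$ be a $\mathrm{B}$-category. For any objects $X$ and $Y$ of $\mathcal{B}$, the set $\mathrm{Hom}(X,Y)$ is finite.
   Context: In a category with finite co-products, write $\mathbf{0}$ for the initial object; an object is empty if it is isomorphic to $\mathbf{0}$. An object $X$ is an atom (atomic) if it is non-empty and, whenever $X \cong Y \amalg Z$, either $Y$ or $Z$ is empty. A $\mathrm{B}$-category is an essentially small category $\mathcal{B}$ such that: (a) $\mathcal{B}$ has finite co-products; (b) every object is isomorphic to a finite co-product of atoms; (c) for objects $X,Y,Z$ with $X$ atomic, the natural map $\mathrm{Hom}(X,Y)\amalg \mathrm{Hom}(X,Z)\to \mathrm{Hom}(X,Y\amalg Z)$ is a bijection; (d) $\mathcal{B}$ has fiber products and a final object $\mathbf{1}$; (e) any monomorphism of atoms is an isomorphism. *)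

theory Defs
  imports Main
begin

text \<open>Both the objects and the arrows of a category form sets, so every category here is
  small, and essential smallness needs no separate hypothesis.
  \<open>Comp C g f\<close> is the composite of \<open>g\<close> after \<open>f\<close>; \<open>Dom\<close>, \<open>Cod\<close>, \<open>Id\<close> and \<open>Comp\<close> are
  unconstrained outside \<open>Obj\<close> and \<open>Arr\<close>.\<close>

record ('o, 'm) cat_data =
  Obj :: "'o set"
  Arr :: "'m set"
  Dom :: "'m \<Rightarrow> 'o"
  Cod :: "'m \<Rightarrow> 'o"
  Id :: "'o \<Rightarrow> 'm"
  Comp :: "'m \<Rightarrow> 'm \<Rightarrow> 'm"

definition hom :: "('o, 'm, 'x) cat_data_scheme \<Rightarrow> 'o \<Rightarrow> 'o \<Rightarrow> 'm set" where
  "hom C X Y = {f \<in> Arr C. Dom C f = X \<and> Cod C f = Y}"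

locale category =
  fixes C :: "('o, 'm, 'x) cat_data_scheme"
  assumes Dom_in_Obj: "f \<in> Arr C \<Longrightarrow> Dom C f \<in> Obj C"
    and Cod_in_Obj: "f \<in> Arr C \<Longrightarrow> Cod C f \<in> Obj C"
    and Id_in_hom: "X \<in> Obj C \<Longrightarrow> Id C X \<in> hom C X X"
    and Comp_in_hom: "f \<in> hom C X Y \<Longrightarrow> g \<in> hom C Y Z \<Longrightarrow> Comp C g f \<in> hom C X Z"
    and Comp_Id_right: "f \<in> hom C X Y \<Longrightarrow> Comp C f (Id C X) = f"
    and Comp_Id_left: "f \<in> hom C X Y \<Longrightarrow> Comp C (Id C Y) f = f"
    and Comp_assoc: "f \<in> hom C W X \<Longrightarrow> g \<in> hom C X Y \<Longrightarrow> h \<in> hom C Y Z \<Longrightarrow>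
      Comp C h (Comp C g f) = Comp C (Comp C h g) f"

definition is_iso :: "('o, 'm, 'x) cat_data_scheme \<Rightarrow> 'o \<Rightarrow> 'o \<Rightarrow> 'm \<Rightarrow> bool" where
  "is_iso C X Y f \<longleftrightarrow> f \<in> hom C X Y \<and>
    (\<exists>g \<in> hom C Y X. Comp C g f = Id C X \<and> Comp C f g = Id C Y)"

definition isomorphic :: "('o, 'm, 'x) cat_data_scheme \<Rightarrow> 'o \<Rightarrow> 'o \<Rightarrow> bool" where
  "isomorphic C X Y \<longleftrightarrow> (\<exists>f. is_iso C X Y f)"

definition is_mono :: "('o, 'm, 'x) cat_data_scheme \<Rightarrow> 'o \<Rightarrow> 'o \<Rightarrow> 'm \<Rightarrow> bool" where
  "is_mono C X Y f \<longleftrightarrow> f \<in> hom C X Y \<and>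
    (\<forall>T \<in> Obj C. \<forall>g \<in> hom C T X. \<forall>h \<in> hom C T X. Comp C f g = Comp C f h \<longrightarrow> g = h)"

definition is_initial :: "('o, 'm, 'x) cat_data_scheme \<Rightarrow> 'o \<Rightarrow> bool" where
  "is_initial C X \<longleftrightarrow> X \<in> Obj C \<and> (\<forall>T \<in> Obj C. \<exists>!f. f \<in> hom C X T)"

definition is_final :: "('o, 'm, 'x) cat_data_scheme \<Rightarrow> 'o \<Rightarrow> bool" where
  "is_final C X \<longleftrightarrow> X \<in> Obj C \<and> (\<forall>T \<in> Obj C. \<exists>!f. f \<in> hom C T X)"

definition is_coproduct ::
  "('o, 'm, 'x) cat_data_scheme \<Rightarrow> 'i set \<Rightarrow> ('i \<Rightarrow> 'o) \<Rightarrow> 'o \<Rightarrow> ('i \<Rightarrow> 'm) \<Rightarrow> bool" where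
  "is_coproduct C I X P \<iota> \<longleftrightarrow> P \<in> Obj C \<and> (\<forall>k \<in> I. \<iota> k \<in> hom C (X k) P) \<and>
    (\<forall>T \<in> Obj C. \<forall>f. (\<forall>k \<in> I. f k \<in> hom C (X k) T) \<longrightarrow>
      (\<exists>!u. u \<in> hom C P T \<and> (\<forall>k \<in> I. Comp C u (\<iota> k) = f k)))"

definition is_binary_coproduct ::
  "('o, 'm, 'x) cat_data_scheme \<Rightarrow> 'o \<Rightarrow> 'o \<Rightarrow> 'o \<Rightarrow> 'm \<Rightarrow> 'm \<Rightarrow> bool" where
  "is_binary_coproduct C Y Z P i j \<longleftrightarrow> P \<in> Obj C \<and> i \<in> hom C Y P \<and> j \<in> hom C Z P \<and>
    (\<forall>T \<in> Obj C. \<forall>f \<in> hom C Y T. \<forall>g \<in> hom C Z T.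
      (\<exists>!u. u \<in> hom C P T \<and> Comp C u i = f \<and> Comp C u j = g))"

definition is_fiber_product ::
  "('o, 'm, 'x) cat_data_scheme \<Rightarrow> 'o \<Rightarrow> 'o \<Rightarrow> 'm \<Rightarrow> 'm \<Rightarrow> 'o \<Rightarrow> 'm \<Rightarrow> 'm \<Rightarrow> bool" where
  "is_fiber_product C X Y f g P p q \<longleftrightarrow> P \<in> Obj C \<and> p \<in> hom C P X \<and> q \<in> hom C P Y \<and>
    Comp C f p = Comp C g q \<and>
    (\<forall>T \<in> Obj C. \<forall>a \<in> hom C T X. \<forall>b \<in> hom C T Y. Comp C f a = Comp C g b \<longrightarrow>
      (\<exists>!u. u \<in> hom C T P \<and> Comp C p u = a \<and> Comp C q u = b))"

text \<open>The case \<open>n = 0\<close> provides the initial object.\<close>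

definition has_finite_coproducts :: "('o, 'm, 'x) cat_data_scheme \<Rightarrow> bool" where
  "has_finite_coproducts C \<longleftrightarrow>
    (\<forall>(n::nat) X. (\<forall>k<n. X k \<in> Obj C) \<longrightarrow> (\<exists>P \<iota>. is_coproduct C {..<n} X P \<iota>))"

definition has_fiber_products :: "('o, 'm, 'x) cat_data_scheme \<Rightarrow> bool" where
  "has_fiber_products C \<longleftrightarrow>
    (\<forall>X \<in> Obj C. \<forall>Y \<in> Obj C. \<forall>Z \<in> Obj C. \<forall>f \<in> hom C X Z. \<forall>g \<in> hom C Y Z.
      \<exists>P p q. is_fiber_product C X Y f g P p q)"

definition is_empty_obj :: "('o, 'm, 'x) cat_data_scheme \<Rightarrow> 'o \<Rightarrow> bool" where
  "is_empty_obj C X \<longleftrightarrow> (\<exists>Z. is_initial C Z \<and> isomorphic C X Z)"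

text \<open>Coproducts are not chosen: \<open>X \<cong> Y \<amalg> Z\<close> reads as \<open>X\<close> being isomorphic to the apex of
  a coproduct cocone on \<open>Y\<close> and \<open>Z\<close>.\<close>

definition is_atom :: "('o, 'm, 'x) cat_data_scheme \<Rightarrow> 'o \<Rightarrow> bool" where
  "is_atom C X \<longleftrightarrow> X \<in> Obj C \<and> \<not> is_empty_obj C X \<and>
    (\<forall>Y \<in> Obj C. \<forall>Z \<in> Obj C. \<forall>P i j. is_binary_coproduct C Y Z P i j \<and> isomorphic C X P \<longrightarrow>
      is_empty_obj C Y \<or> is_empty_obj C Z)"

locale B_category = category C for C :: "('o, 'm, 'x) cat_data_scheme" +
  assumes finite_coproducts: "has_finite_coproducts C"
    and atomic_decomposition: "X \<in> Obj C \<Longrightarrow>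
      \<exists>(n::nat) A P \<iota>. (\<forall>k<n. is_atom C (A k)) \<and> is_coproduct C {..<n} A P \<iota> \<and> isomorphic C X P"
    and hom_atom_coproduct: "is_atom C X \<Longrightarrow> Y \<in> Obj C \<Longrightarrow> Z \<in> Obj C \<Longrightarrow>
      is_binary_coproduct C Y Z P i j \<Longrightarrow>
      bij_betw (case_sum (Comp C i) (Comp C j)) (hom C X Y <+> hom C X Z) (hom C X P)"
    and fiber_products: "has_fiber_products C"
    and final_object: "\<exists>T. is_final C T"
    and mono_atoms_iso: "is_atom C X \<Longrightarrow> is_atom C Y \<Longrightarrow> is_mono C X Y f \<Longrightarrow> is_iso C X Y f"

end

theory Submission imports Defs "HOL-Library.FuncSet" begin

text \<open>Decomposing the source reduces the claim to an atom \<open>X\<close>. Decompose \<open>X \<times> Y\<close>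
  into finitely many atoms. The graph of a map \<open>f : X \<rightarrow> Y\<close> is a section of the first projection,
  and it factors through one of these atoms \<open>W\<close>. The factor \<open>X \<rightarrow> W\<close> is a monomorphism of atoms,
  hence an isomorphism, inverse to the projection \<open>W \<rightarrow> X\<close>. So \<open>W\<close> determines \<open>f\<close>.\<close>

section \<open>Split monomorphisms and coproducts in an arbitrary category\<close>

context category
begin

lemma hom_Obj: "f \<in> hom C X Y \<Longrightarrow> X \<in> Obj C \<and> Y \<in> Obj C"
  using Dom_in_Obj Cod_in_Obj by (auto simp: hom_def)

text \<open>Composing with the retraction \<open>r\<close> cancels \<open>u\<close>. This produces
  the monomorphisms to which \<open>mono_atoms_iso\<close> is applied.\<close>

lemma split_mono_is_mono:
  assumes u: "u \<in> hom C X W" and r: "r \<in> hom C W X" and ru: "Comp C r u = Id C X"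
  shows "is_mono C X W u"
  unfolding is_mono_def
proof (intro conjI ballI impI)
  fix T g h assume g: "g \<in> hom C T X" and h: "h \<in> hom C T X" and e: "Comp C u g = Comp C u h"
  have "g = Comp C (Comp C r u) g" using Comp_Id_left[OF g] ru by simp
  also have "\<dots> = Comp C r (Comp C u g)" using Comp_assoc[OF g u r] by simp
  also have "\<dots> = Comp C (Comp C r u) h" using Comp_assoc[OF h u r] e by simp
  also have "\<dots> = h" using Comp_Id_left[OF h] ru by simp
  finally show "g = h" .
qed (fact u)

text \<open>A one-sided inverse of an isomorphism is two-sided, so \<open>r\<close> is itself
  invertible and has only one section.\<close>

lemma iso_right_inverse_unique:
  assumes u: "is_iso C X W u" and v: "v \<in> hom C X W" and r: "r \<in> hom C W X"
    and ru: "Comp C r u = Id C X" and rv: "Comp C r v = Id C X"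
  shows "u = v"
proof -
  have uh: "u \<in> hom C X W" using u by (simp add: is_iso_def)
  obtain s where s: "s \<in> hom C W X" "Comp C u s = Id C W"
    using u by (auto simp: is_iso_def)
  have "r = Comp C r (Comp C u s)" using Comp_Id_right[OF r] s by simp
  also have "\<dots> = s" using Comp_assoc[OF s(1) uh r] ru Comp_Id_left[OF s(1)] by simp
  finally have "Comp C u r = Id C W" using s by simp
  then have "v = Comp C (Comp C u r) v" using Comp_Id_left[OF v] by simp
  also have "\<dots> = u" using Comp_assoc[OF v r uh] rv Comp_Id_right[OF uh] by simp
  finally show ?thesis by simp
qed

lemma is_coproductD:
  assumes "is_coproduct C I X P \<iota>"
  shows "P \<in> Obj C" and "\<And>k. k \<in> I \<Longrightarrow> \<iota> k \<in> hom C (X k) P"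
    and "\<And>T f. T \<in> Obj C \<Longrightarrow> (\<And>k. k \<in> I \<Longrightarrow> f k \<in> hom C (X k) T) \<Longrightarrow>
      \<exists>!u. u \<in> hom C P T \<and> (\<forall>k \<in> I. Comp C u (\<iota> k) = f k)"
  using assms unfolding is_coproduct_def by blast+

lemma coproduct_ext:
  assumes P: "is_coproduct C I X P \<iota>" and u: "u \<in> hom C P T" and v: "v \<in> hom C P T"
    and e: "\<And>k. k \<in> I \<Longrightarrow> Comp C u (\<iota> k) = Comp C v (\<iota> k)"
  shows "u = v"
proof -
  \<comment> \<open>The cocone consists of the restrictions of \<open>u\<close> itself, so
    \<open>u\<close> and \<open>v\<close> both solve the same universal problem.\<close>
  have "\<exists>!w. w \<in> hom C P T \<and> (\<forall>k \<in> I. Comp C w (\<iota> k) = Comp C u (\<iota> k))"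
    using hom_Obj[OF u] by (intro is_coproductD(3)[OF P] Comp_in_hom[OF is_coproductD(2)[OF P] u]) auto
  then show ?thesis using u v e by metis
qed

text \<open>The injections are transported along the inverse of \<open>h\<close>. Since
  \<open>atomic_decomposition\<close> gives an object only up to isomorphism, this is what makes the
  object itself the apex of a coproduct of atoms.\<close>

lemma coproduct_isomorphic:
  assumes P: "is_coproduct C I X P \<iota>" and iso: "is_iso C Q P h"
  shows "\<exists>\<kappa>. is_coproduct C I X Q \<kappa>"
proof -
  obtain g where h: "h \<in> hom C Q P" and g: "g \<in> hom C P Q"
    and gh: "Comp C g h = Id C Q" and hg: "Comp C h g = Id C P"
    using iso by (auto simp: is_iso_def)
  note PD = is_coproductD[OF P]
  have "is_coproduct C I X Q (\<lambda>k. Comp C g (\<iota> k))"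
    unfolding is_coproduct_def
  proof (intro conjI ballI allI impI)
    show "Q \<in> Obj C" using hom_Obj[OF h] by simp
    show "Comp C g (\<iota> k) \<in> hom C (X k) Q" if "k \<in> I" for k
      using Comp_in_hom PD(2)[OF that] g by blast
    fix T f assume T: "T \<in> Obj C" and f: "\<forall>k\<in>I. f k \<in> hom C (X k) T"
    obtain u where u: "u \<in> hom C P T" "\<forall>k\<in>I. Comp C u (\<iota> k) = f k"
      using PD(3)[OF T, of f] f by blast
    show "\<exists>!v. v \<in> hom C Q T \<and> (\<forall>k\<in>I. Comp C v (Comp C g (\<iota> k)) = f k)"
    proof (intro ex1I[of _ "Comp C u h"] conjI ballI)
      show uh: "Comp C u h \<in> hom C Q T" using Comp_in_hom h u by blast
      show "Comp C (Comp C u h) (Comp C g (\<iota> k)) = f k" if "k \<in> I" for k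
      proof -
        have "Comp C (Comp C u h) (Comp C g (\<iota> k)) = Comp C (Comp C (Comp C u h) g) (\<iota> k)"
          using Comp_assoc[OF PD(2)[OF that] g uh] .
        also have "Comp C (Comp C u h) g = u"
          using Comp_assoc[OF g h u(1)] hg Comp_Id_right[OF u(1)] by simp
        finally show ?thesis using u that by simp
      qed
      fix v assume v: "v \<in> hom C Q T \<and> (\<forall>k\<in>I. Comp C v (Comp C g (\<iota> k)) = f k)"
      then have vg: "Comp C v g \<in> hom C P T" using Comp_in_hom g by blast
      \<comment> \<open>Both sides restrict to \<open>f k\<close> along each
        \<open>\<iota> k\<close>; precomposing with \<open>h\<close> afterwards cancels
        \<open>g\<close>.\<close>
      have "Comp C v g = u"
      proof (rule coproduct_ext[OF P vg u(1)])
        fix k assume k: "k \<in> I"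
        then show "Comp C (Comp C v g) (\<iota> k) = Comp C u (\<iota> k)"
          using Comp_assoc[OF PD(2)[OF k] g, of v T] v u(2) by simp
      qed
      then show "v = Comp C u h"
        using Comp_assoc[OF h g, of v T] v gh Comp_Id_right[of v Q T] by simp
    qed
  qed
  then show ?thesis by blast
qed

text \<open>Associativity of coproducts, splitting off the last summand so that the binary condition
  \<open>hom_atom_coproduct\<close> can drive an induction on \<open>n\<close>. The second
  conclusion keeps the injections compatible.\<close>

lemma coproduct_Suc_binary:
  assumes P: "is_coproduct C {..<Suc n} X P \<iota>" and Q: "is_coproduct C {..<n} X Q \<kappa>"
  obtains i where "is_binary_coproduct C Q (X n) P i (\<iota> n)"
    and "\<And>k. k < n \<Longrightarrow> Comp C i (\<kappa> k) = \<iota> k"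
proof -
  note PD = is_coproductD[OF P] and QD = is_coproductD[OF Q]
  have "\<iota> k \<in> hom C (X k) P" if "k \<in> {..<n}" for k
    using PD(2)[of k] that by simp
  from QD(3)[OF PD(1), of \<iota>, OF this]
  obtain i where i: "i \<in> hom C Q P" "\<And>k. k < n \<Longrightarrow> Comp C i (\<kappa> k) = \<iota> k"
    by auto
  have "is_binary_coproduct C Q (X n) P i (\<iota> n)"
    unfolding is_binary_coproduct_def
  proof (intro conjI ballI)
    show "P \<in> Obj C" by (fact PD)
    show "i \<in> hom C Q P" by (fact i)
    show "\<iota> n \<in> hom C (X n) P" using PD(2)[of n] by simp
    fix T f g assume T: "T \<in> Obj C" and f: "f \<in> hom C Q T" and g: "g \<in> hom C (X n) T"
    \<comment> \<open>A pair \<open>f\<close>, \<open>g\<close> on \<open>Q\<close> and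
      \<open>X n\<close> is the same as a cocone on all \<open>Suc n\<close> summands: unfold
      \<open>f\<close> along \<open>\<kappa>\<close> and put \<open>g\<close> at index
      \<open>n\<close>.\<close>
    define F where "F k = (if k = n then g else Comp C f (\<kappa> k))" for k
    have "F k \<in> hom C (X k) T" if "k \<in> {..<Suc n}" for k
      using that g Comp_in_hom[OF QD(2) f, of k] by (auto simp: F_def less_Suc_eq)
    from PD(3)[OF T, of F, OF this]
    obtain u where u: "u \<in> hom C P T" "\<And>k. k < Suc n \<Longrightarrow> Comp C u (\<iota> k) = F k"
      by auto
    have assoc: "Comp C (Comp C v i) (\<kappa> k) = Comp C v (\<iota> k)"
      if "v \<in> hom C P T" "k < n" for v k
      using Comp_assoc[OF QD(2) i(1) that(1), of k] i(2)[OF that(2)] that(2) by simp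
    show "\<exists>!u. u \<in> hom C P T \<and> Comp C u i = f \<and> Comp C u (\<iota> n) = g"
    proof (intro ex1I[of _ u] conjI)
      show "Comp C u i = f"
        using coproduct_ext[OF Q Comp_in_hom[OF i(1) u(1)] f] assoc[OF u(1)] u(2)
        by (simp add: F_def)
      fix v assume v: "v \<in> hom C P T \<and> Comp C v i = f \<and> Comp C v (\<iota> n) = g"
      have "Comp C v (\<iota> k) = F k" if "k < Suc n" for k
        using v assoc[of v k] that by (auto simp: F_def less_Suc_eq)
      then show "v = u"
        using coproduct_ext[OF P _ u(1), of v] v u(2) by simp
    qed (use u in \<open>simp_all add: F_def\<close>)
  qed
  then show thesis using i that by blast
qed

text \<open>An arrow out of a coproduct is determined by its restrictions, so the hom-set embeds in
  a finite product of finite hom-sets.\<close>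

lemma finite_hom_coproduct:
  assumes P: "is_coproduct C I X P \<iota>" and "finite I"
    and fin: "\<And>k. k \<in> I \<Longrightarrow> finite (hom C (X k) T)"
  shows "finite (hom C P T)"
proof (rule inj_on_finite)
  let ?F = "\<lambda>u. restrict (\<lambda>k. Comp C u (\<iota> k)) I"
  show "inj_on ?F (hom C P T)"
  proof (rule inj_onI, rule coproduct_ext[OF P])
    fix u v k assume "?F u = ?F v" and "k \<in> I"
    then show "Comp C u (\<iota> k) = Comp C v (\<iota> k)" by (auto dest: fun_cong[of _ _ k])
  qed
  show "?F ` hom C P T \<subseteq> (\<Pi>\<^sub>E k\<in>I. hom C (X k) T)"
    by (auto intro: Comp_in_hom[OF is_coproductD(2)[OF P]])
  show "finite (\<Pi>\<^sub>E k\<in>I. hom C (X k) T)" using assms by (intro finite_PiE)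
qed

end

section \<open>Atoms, binary products and finiteness in a B-category\<close>

context B_category
begin

lemma atomic_coproduct:
  assumes "X \<in> Obj C"
  obtains n :: nat and A \<iota> where "\<And>k. k < n \<Longrightarrow> is_atom C (A k)" and "is_coproduct C {..<n} A X \<iota>"
proof -
  obtain n :: nat and A P \<iota> h where "\<And>k. k < n \<Longrightarrow> is_atom C (A k)"
    and "is_coproduct C {..<n} A P \<iota>" and "is_iso C X P h"
    using atomic_decomposition[OF assms] unfolding isomorphic_def by blast
  then show thesis using coproduct_isomorphic that by blast
qed

text \<open>An initial object is the coproduct of two copies of itself with equal injections, so the
  two branches of the bijection for \<open>Hom(X, Z \<amalg> Z)\<close> have the same image.\<close>

lemma hom_atom_initial:
  assumes X: "is_atom C X" and Z: "is_initial C Z"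
  shows "hom C X Z = {}"
proof (rule ccontr)
  assume "hom C X Z \<noteq> {}"
  then obtain f where f: "f \<in> hom C X Z" by blast
  have ZO: "Z \<in> Obj C" and Id: "Id C Z \<in> hom C Z Z"
    using Z Id_in_hom by (auto simp: is_initial_def)
  have "is_binary_coproduct C Z Z Z (Id C Z) (Id C Z)"
    unfolding is_binary_coproduct_def
  proof (intro conjI ballI)
    fix T g h assume g: "g \<in> hom C Z T" and h: "h \<in> hom C Z T"
    then have "g = h" using Z hom_Obj[OF g] by (auto simp: is_initial_def)
    then show "\<exists>!u. u \<in> hom C Z T \<and> Comp C u (Id C Z) = g \<and> Comp C u (Id C Z) = h"
      using g Comp_Id_right by metis
  qed (fact ZO Id)+
  from hom_atom_coproduct[OF X ZO ZO this]
  have "inj_on (case_sum (Comp C (Id C Z)) (Comp C (Id C Z))) (hom C X Z <+> hom C X Z)"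
    by (simp add: bij_betw_def)
  from inj_onD[OF this, of "Inl f" "Inr f"] f show False by (auto simp: Plus_def)
qed

text \<open>Surjectivity in \<open>hom_atom_coproduct\<close> sends an arrow from an atom into one
  of two summands; induction on \<open>n\<close> extends this to finite coproducts.\<close>

lemma atom_factors_through_summand:
  assumes A: "is_atom C A" and "is_coproduct C {..<n::nat} X P \<iota>"
    and "\<And>k. k < n \<Longrightarrow> X k \<in> Obj C" and "f \<in> hom C A P"
  shows "\<exists>k<n. \<exists>g \<in> hom C A (X k). f = Comp C (\<iota> k) g"
  using assms(2-)
proof (induction n arbitrary: P \<iota> f)
  case 0
  \<comment> \<open>The apex of the empty coproduct is initial, and an atom has no arrow to it, so
    \<open>f\<close> cannot exist.\<close>
  then have "is_initial C P" by (auto simp: is_initial_def is_coproduct_def)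
  then show ?case using hom_atom_initial[OF A] 0 by auto
next
  case (Suc n)
  have "\<forall>k<n. X k \<in> Obj C" using Suc.prems by simp
  then obtain Q \<kappa> where Q: "is_coproduct C {..<n} X Q \<kappa>"
    using finite_coproducts unfolding has_finite_coproducts_def by meson
  note QD = is_coproductD[OF Q]
  obtain i where bin: "is_binary_coproduct C Q (X n) P i (\<iota> n)"
    and i: "\<And>k. k < n \<Longrightarrow> Comp C i (\<kappa> k) = \<iota> k"
    using coproduct_Suc_binary[OF Suc.prems(1) Q] by metis
  have "hom C A P = case_sum (Comp C i) (Comp C (\<iota> n)) ` (hom C A Q <+> hom C A (X n))"
    using hom_atom_coproduct[OF A QD(1) _ bin] Suc.prems(2) by (simp add: bij_betw_def)
  with Suc.prems(3) consider g where "g \<in> hom C A Q" "f = Comp C i g"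
    | g where "g \<in> hom C A (X n)" "f = Comp C (\<iota> n) g"
    by auto
  then show ?case
  proof cases
    case (1 g)
    obtain k h where k: "k < n" and h: "h \<in> hom C A (X k)" and g: "g = Comp C (\<kappa> k) h"
      using Suc.IH[OF Q _ 1(1)] Suc.prems(2) by auto
    have "i \<in> hom C Q P" using bin by (simp add: is_binary_coproduct_def)
    then have "f = Comp C (\<iota> k) h"
      using 1(2) g Comp_assoc[OF h QD(2)] i[OF k] k by (metis lessThan_iff)
    then show ?thesis using k h less_SucI by blast
  qed blast
qed

text \<open>The fiber product over a final object, where every square commutes. The pairing property
  is what allows graphs of arrows to be formed.\<close>

lemma binary_product:
  assumes X: "X \<in> Obj C" and Y: "Y \<in> Obj C"
  obtains P p q where "P \<in> Obj C" and "p \<in> hom C P X" and "q \<in> hom C P Y"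
    and "\<And>T a b. a \<in> hom C T X \<Longrightarrow> b \<in> hom C T Y \<Longrightarrow>
      \<exists>u \<in> hom C T P. Comp C p u = a \<and> Comp C q u = b"
proof -
  obtain E where E: "is_final C E" using final_object by blast
  then obtain f g where f: "f \<in> hom C X E" and g: "g \<in> hom C Y E"
    using X Y by (meson is_final_def)
  obtain P p q where P: "is_fiber_product C X Y f g P p q"
    using fiber_products[unfolded has_fiber_products_def, rule_format, OF X Y _ f g] hom_Obj[OF f]
    by auto
  show thesis
  proof (rule that[of P p q])
    fix T a b assume a: "a \<in> hom C T X" and b: "b \<in> hom C T Y"
    have T: "T \<in> Obj C" using hom_Obj[OF a] by simp
    have "Comp C f a = Comp C g b"
      using E T Comp_in_hom[OF a f] Comp_in_hom[OF b g] unfolding is_final_def by metis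
    then show "\<exists>u \<in> hom C T P. Comp C p u = a \<and> Comp C q u = b"
      using P T a b unfolding is_fiber_product_def by meson
  qed (use P in \<open>simp_all add: is_fiber_product_def\<close>)
qed

lemma finite_hom_atom:
  assumes X: "is_atom C X" and Y: "Y \<in> Obj C"
  shows "finite (hom C X Y)"
proof -
  have XO: "X \<in> Obj C" using X by (simp add: is_atom_def)
  obtain P p q where P: "P \<in> Obj C" and p: "p \<in> hom C P X" and q: "q \<in> hom C P Y"
    and pair: "\<And>T a b. a \<in> hom C T X \<Longrightarrow> b \<in> hom C T Y \<Longrightarrow>
      \<exists>u \<in> hom C T P. Comp C p u = a \<and> Comp C q u = b"
    using binary_product[OF XO Y] by metis
  obtain n :: nat and W \<iota> where W: "\<And>k. k < n \<Longrightarrow> is_atom C (W k)"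
    and cop: "is_coproduct C {..<n} W P \<iota>"
    using atomic_coproduct[OF P] by metis
  have \<iota>: "\<iota> k \<in> hom C (W k) P" if "k < n" for k
    using is_coproductD(2)[OF cop] that by simp
  \<comment> \<open>\<open>R f k\<close> says that the graph of \<open>f\<close> factors through the
    atom \<open>W k\<close>: the composite of \<open>u\<close> with \<open>\<iota> k\<close> has
    first component the identity and second component \<open>f\<close>.\<close>
  define R where "R f k \<longleftrightarrow> k < n \<and> (\<exists>u \<in> hom C X (W k).
    Comp C p (Comp C (\<iota> k) u) = Id C X \<and> Comp C q (Comp C (\<iota> k) u) = f)" for f k
  have "\<exists>k. R f k" if f: "f \<in> hom C X Y" for f
  proof -
    obtain \<gamma> where "\<gamma> \<in> hom C X P" "Comp C p \<gamma> = Id C X" "Comp C q \<gamma> = f"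
      using pair[OF Id_in_hom[OF XO] f] by blast
    moreover from this(1) obtain k u where "k < n" "u \<in> hom C X (W k)" "\<gamma> = Comp C (\<iota> k) u"
      using atom_factors_through_summand[OF X cop] W unfolding is_atom_def by blast
    ultimately show ?thesis by (auto simp: R_def)
  qed
  \<comment> \<open>One atom is chosen for each \<open>f\<close>, as its graph might a priori
    satisfy \<open>R\<close> for several indices.\<close>
  then have ex: "\<forall>f \<in> hom C X Y. R f (SOME k. R f k)" by (auto intro: someI_ex)
  have uniq: "f = g" if fk: "R f k" and gk: "R g k" for f g k
  proof -
    obtain u v where k: "k < n" and u: "u \<in> hom C X (W k)" and v: "v \<in> hom C X (W k)"
      and pu: "Comp C p (Comp C (\<iota> k) u) = Id C X" and pv: "Comp C p (Comp C (\<iota> k) v) = Id C X"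
      and f: "Comp C q (Comp C (\<iota> k) u) = f" and g: "Comp C q (Comp C (\<iota> k) v) = g"
      using fk gk by (auto simp: R_def)
    \<comment> \<open>The projection from the atom \<open>W k\<close> to \<open>X\<close>; both
      \<open>u\<close> and \<open>v\<close> are sections of it.\<close>
    let ?r = "Comp C p (\<iota> k)"
    have r: "?r \<in> hom C (W k) X" using Comp_in_hom[OF \<iota>[OF k] p] .
    have ru: "Comp C ?r u = Id C X" and rv: "Comp C ?r v = Id C X"
      using Comp_assoc[OF u \<iota>[OF k] p] Comp_assoc[OF v \<iota>[OF k] p] pu pv by simp_all
    have "is_iso C X (W k) u"
      using mono_atoms_iso[OF X W[OF k] split_mono_is_mono[OF u r ru]] .
    then have "u = v" using iso_right_inverse_unique v r ru rv by blast
    then show ?thesis using f g by simp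
  qed
  show ?thesis
  proof (rule inj_on_finite)
    \<comment> \<open>By \<open>uniq\<close> the chosen index recovers \<open>f\<close>, so there
      are at most \<open>n\<close> arrows, one per atom of the product.\<close>
    show "inj_on (\<lambda>f. SOME k. R f k) (hom C X Y)"
    proof (rule inj_onI)
      fix f g assume "f \<in> hom C X Y" "g \<in> hom C X Y" "(SOME k. R f k) = (SOME k. R g k)"
      then show "f = g" using ex uniq[of f "SOME k. R f k" g] by auto
    qed
    show "(\<lambda>f. SOME k. R f k) ` hom C X Y \<subseteq> {..<n}"
      using ex by (auto simp: R_def)
  qed simp
qed

end

theorem proposition3p17:
  fixes C :: "('o, 'm, 'x) cat_data_scheme"
    and X Y :: 'o
  assumes "B_category C"
    and "X \<in> Obj C" and "Y \<in> Obj C"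
  shows "finite (hom C X Y)"
proof -
  interpret B_category C by fact
  \<comment> \<open>Decomposing the source leaves only arrows from atoms to count;
    \<open>n = 0\<close> covers an empty \<open>X\<close>.\<close>
  obtain n :: nat and A \<iota> where "\<And>k. k < n \<Longrightarrow> is_atom C (A k)" "is_coproduct C {..<n} A X \<iota>"
    using atomic_coproduct[OF \<open>X \<in> Obj C\<close>] by metis
  then show ?thesis
    using finite_hom_atom \<open>Y \<in> Obj C\<close> by (auto intro: finite_hom_coproduct)
qed

end
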